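(* Under the standing assumptions of the context on $v$ and $\lambda_0$, let $(\Lambda_1,\Lambda_2)$ be a sufficiently small neighborhood of $\lambda_0$ and let $\ell\in\{1,\ldots,L\}$. Let $\epsilon_\ell(\lambda,\hbar)$ be a real function, continuously differentiable in $\lambda\in(\Lambda_1,\Lambda_2)$, such that, uniformly in $\lambda$, $$\epsilon_\ell(\lambda,\hbar)=O(\hbar),\qquad \partial_\lambda\epsilon_\ell(\lambda,\hbar)=o(\hbar^{-1}),\qquad \hbar\to0 .$$ Consider those $\lambda\in(\Lambda_1,\Lambda_2)$ that satisfy $$\cos\big(\hbar^{-1}\Phi_\ell(\lambda)\big)+\epsilon_\ell(\lambda,\hbar)=0 .$$ Then, for sufficiently small $\hbar$ and for every integer $n$ such that $\Phi_\ell^{-1}(\pi(n+1/2)\hbar)$ belongs to $(\Lambda_1,\Lambda_2)$, there is at most one such $\lambda=\lambda_{n,\ell}(\hbar)$ satisfying the condition $\Phi_\ell(\lambda)=\pi(n+1/2)\hbar+O(\hbar^2)$. (That is: for every $C>0$ there is $\hbar_0>0$ such that for $\hbar\in(0,\hbar_0)$ and every such $n$ at most one $\lambda\in(\Lambda_1,\Lambda_2)$ satisfies both the displayed equation and $|\Phi_\ell(\lambda)-\pi(n+1/2)\hbar|\le C\hbar^2$.)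
   Context: Standing assumptions: $v\in C^2(\mathbb R)$ is real, $\lambda_0\in\mathbb R$; the equation $v(x)=\lambda_0$ has only a finite number of solutions, $v'(x)\ne0$ at each of them, and $v\in C^3$ in some neighborhoods of these points; $\liminf_{x\to\pm\infty}v(x)>\lambda_0$; and, for some $\rho_0>1$ and a fixed point $x_0$ with $v(x_0)=\lambda_0$, the function $$\big(|v(x)-\lambda_0|^{-3}v'(x)^2+|v(x)-\lambda_0|^{-2}|v''(x)|\big)\Big|\int_{x_0}^x|v(y)-\lambda_0|^{1/2}dy\Big|^{\rho_0}$$ is bounded as $|x|\to\infty$. For $\lambda$ in a sufficiently small neighborhood $(\Lambda_1,\Lambda_2)$ of $\lambda_0$, containing no critical values of $v$ and with closure below $\liminf_{|x|\to\infty}v$, the solutions of $v(x)=\lambda$ are enumerated as $x_{1,-}(\lambda)<x_{1,+}(\lambda)<\cdots<x_{L,-}(\lambda)<x_{L,+}(\lambda)$, with $v<\lambda$ exactly on the wells $X_\ell(\lambda)=(x_{\ell,-}(\lambda),x_{\ell,+}(\lambda))$, $\ell=1,\ldots,L$. Set $\Phi_\ell(\lambda)=\int_{x_{\ell,-}(\lambda)}^{x_{\ell,+}(\lambda)}(\lambda-v(x))^{1/2}dx$; $\Phi_\ell$ is a $C^1$ function with positive derivative on $(\Lambda_1,\Lambda_2)$, and $\Phi_\ell^{-1}$ denotes its inverse. *)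

theory Defs
  imports "HOL-Analysis.Analysis"
begin

text \<open>Meant for open \<open>S\<close>: the derivatives are two-sided and may use values outside \<open>S\<close> otherwise.\<close>

definition Ck_on :: "nat \<Rightarrow> (real \<Rightarrow> real) \<Rightarrow> real set \<Rightarrow> bool" where
  "Ck_on k f S \<longleftrightarrow>
     (\<forall>j<k. \<forall>x\<in>S. (deriv ^^ j) f field_differentiable at x) \<and>
     (\<forall>j\<le>k. continuous_on S ((deriv ^^ j) f))"

definition turning_set :: "(real \<Rightarrow> real) \<Rightarrow> real \<Rightarrow> real set" where
  "turning_set v lam = {x. v x = lam}"

definition standing_assumptions :: "(real \<Rightarrow> real) \<Rightarrow> real \<Rightarrow> bool" where
  "standing_assumptions v lam0 \<longleftrightarrow>
     Ck_on 2 v UNIV \<and>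
     finite (turning_set v lam0) \<and>
     (\<forall>x\<in>turning_set v lam0. deriv v x \<noteq> 0) \<and>
     (\<forall>x\<in>turning_set v lam0. \<exists>U. open U \<and> x \<in> U \<and> Ck_on 3 v U) \<and>
     ereal lam0 < Liminf at_top (\<lambda>x. ereal (v x)) \<and>
     ereal lam0 < Liminf at_bot (\<lambda>x. ereal (v x)) \<and>
     (\<exists>rho0>1. \<exists>x0. v x0 = lam0 \<and>
        Bfun (\<lambda>x. (\<bar>v x - lam0\<bar> powr (-3) * (deriv v x)\<^sup>2
                    + \<bar>v x - lam0\<bar> powr (-2) * \<bar>deriv (deriv v) x\<bar>)
                  * \<bar>LBINT y=ereal x0..ereal x. \<bar>v y - lam0\<bar> powr (1/2)\<bar> powr rho0) at_infinity)"

text \<open>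
  Under the standing assumptions and for \<open>lam\<close> near \<open>lam0\<close>, the equation \<open>v x = lam\<close> has exactly
  \<open>2 * num_wells v lam0\<close> solutions, all simple, and \<open>v > lam\<close> near both infinities. Hence the
  solutions in increasing order are alternately left and right endpoints of the
  components of the set where \<open>v < lam\<close>. Wells are numbered from \<open>1\<close>, list positions from \<open>0\<close>.
\<close>

definition num_wells :: "(real \<Rightarrow> real) \<Rightarrow> real \<Rightarrow> nat" where
  "num_wells v lam0 = card (turning_set v lam0) div 2"

definition x_minus :: "(real \<Rightarrow> real) \<Rightarrow> nat \<Rightarrow> real \<Rightarrow> real" where
  "x_minus v l lam = sorted_list_of_set (turning_set v lam) ! (2 * l - 2)"

definition x_plus :: "(real \<Rightarrow> real) \<Rightarrow> nat \<Rightarrow> real \<Rightarrow> real" where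
  "x_plus v l lam = sorted_list_of_set (turning_set v lam) ! (2 * l - 1)"

definition Phi :: "(real \<Rightarrow> real) \<Rightarrow> nat \<Rightarrow> real \<Rightarrow> real" where
  "Phi v l lam =
     (LBINT x=ereal (x_minus v l lam)..ereal (x_plus v l lam). (lam - v x) powr (1/2))"

text \<open>
  The conditions on the error term \<open>eps lam h\<close> on the interval \<open>I\<close>. As only the limit \<open>h \<rightarrow> 0+\<close>
  is concerned, they are imposed for small positive \<open>h\<close> only.
\<close>

definition admissible_error :: "real set \<Rightarrow> (real \<Rightarrow> real \<Rightarrow> real) \<Rightarrow> bool" where
  "admissible_error I eps \<longleftrightarrow>
     (\<forall>\<^sub>F h in at_right 0. Ck_on 1 (\<lambda>lam. eps lam h) I) \<and>
     (\<exists>K. \<forall>\<^sub>F h in at_right 0. \<forall>lam\<in>I. \<bar>eps lam h\<bar> \<le> K * h) \<and>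
     (\<forall>c>0. \<forall>\<^sub>F h in at_right 0. \<forall>lam\<in>I. \<bar>deriv (\<lambda>mu. eps mu h) lam\<bar> \<le> c / h)"

end

theory Submission
  imports Defs
begin

text \<open>
  Uniqueness rests on comparing two rates of change in \<open>\<lambda>\<close>.  The action \<open>\<Phi>\<close> grows at least
  linearly, \<open>\<Phi> \<mu> - \<Phi> \<lambda> \<ge> \<kappa> (\<mu> - \<lambda>)\<close> with some \<open>\<kappa> > 0\<close>.  If \<open>\<Phi> \<lambda>\<close> and \<open>\<Phi> \<mu>\<close> both lie within
  \<open>C h\<^sup>2\<close> of \<open>\<pi> (n + 1/2) h\<close>, then both phases \<open>\<Phi>/h\<close> are within \<open>C h\<close> of the zero \<open>\<pi> (n + 1/2)\<close> of
  the cosine, where its slope is close to \<open>1\<close> in absolute value.  So \<open>cos (\<Phi>/h)\<close> changes by at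
  least \<open>\<kappa> (\<mu> - \<lambda>) / (2 h)\<close> between the two energies, while the error term, whose derivative is
  \<open>o(1/h)\<close>, changes by at most \<open>\<kappa> (\<mu> - \<lambda>) / (4 h)\<close>.  Two distinct energies therefore cannot both
  satisfy the quantization condition (\<open>quantized_energy_unique\<close>).

  The lower bound on the growth of \<open>\<Phi>\<close> (\<open>Phi_expanding\<close>) is obtained without differentiating the
  singular integral: wells grow with the energy, every well near the reference energy contains one
  fixed interval, and on that interval \<open>sqrt (\<mu> - v) - sqrt (\<lambda> - v)\<close> is bounded below by a
  multiple of \<open>\<mu> - \<lambda>\<close>.

  What remains is to see that the list positions \<open>2 l - 2\<close> and \<open>2 l - 1\<close> in the sorted list of
  solutions of \<open>v x = \<lambda>\<close> really bound a well, and that this well stays near the one at the reference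
  energy.  Simple zeros can be isolated by small intervals on which \<open>v\<close> is injective, away from which
  \<open>v\<close> stays away from the reference energy (\<open>isolation_exists\<close>); hence each of them persists as
  exactly one solution at nearby energies, in the same order (\<open>turning_points_persist\<close>).  Which gaps
  between consecutive solutions are wells is decided by counting sign changes from the left, starting
  from positivity near \<open>-\<infinity>\<close> (\<open>sign_eq_parity_of_zeros_below\<close>).
\<close>

section \<open>Signs of a function with simple zeros\<close>

text \<open>
  Local injectivity at the zeros is the form of simplicity that matters: a continuous injective
  function is strictly monotone, so it changes sign at each zero.  The induction removes the
  largest zero below \<open>x\<close> by stepping to a point just left of it.
\<close>

lemma sign_eq_parity_of_zeros_below:
  fixes f :: "real \<Rightarrow> real"
  assumes cont: "continuous_on UNIV f"
    and fin: "finite {z. f z = 0}"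
    and inj: "\<And>z. f z = 0 \<Longrightarrow> \<exists>r>0. inj_on f {z - r..z + r}"
    and left: "\<forall>\<^sub>F x in at_bot. f x > 0"
    and "f x \<noteq> 0"
  shows "f x > 0 \<longleftrightarrow> even (card {z. f z = 0 \<and> z < x})"
  using \<open>f x \<noteq> 0\<close>
proof (induction "card {z. f z = 0 \<and> z < x}" arbitrary: x)
  case (0 x)
  have fin': "finite {z. f z = 0 \<and> z < x}"
    by (rule finite_subset[OF _ fin]) auto
  have none: "f z \<noteq> 0" if "z \<le> x" for z
    using 0 fin' that by (cases "z = x") auto
  obtain y where y: "y \<le> x" "f y > 0"
    using left unfolding eventually_at_bot_linorder by (metis min.cobounded1 min.cobounded2)
  have "f x > 0"
  proof (rule ccontr)
    assume "\<not> f x > 0"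
    then obtain z where "y \<le> z" "z \<le> x" "f z = 0"
      using IVT2'[of f x 0 y] y continuous_on_subset[OF cont] by fastforce
    with none show False by blast
  qed
  with 0 show ?case by auto
next
  case (Suc n x)
  let ?Z = "\<lambda>x. {z. f z = 0 \<and> z < x}"
  have fin': "finite (?Z x)" for x
    by (rule finite_subset[OF _ fin]) auto
  define z where "z = Max (?Z x)"
  have ne: "?Z x \<noteq> {}" using Suc.hyps(2) by force
  have z: "f z = 0" "z < x"
    using Max_in[OF fin' ne] by (auto simp: z_def)
  have zmax: "y \<le> z" if "f y = 0" "y < x" for y
    using that fin' by (auto simp: z_def)
  obtain r0 where r0: "r0 > 0" "inj_on f {z - r0..z + r0}" using inj[OF z(1)] by blast
  \<comment> \<open>The cut at \<open>x - z\<close> keeps \<open>z + r\<close> to the left of \<open>x\<close>, so no zero lies between them.\<close>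
  define r where "r = min r0 (x - z)"
  have r: "r > 0" "r \<le> r0" "z + r \<le> x" using r0 z by (auto simp: r_def)
  have injr: "inj_on f {z - r..z + r}"
    by (rule inj_on_subset[OF r0(2)]) (use r in auto)
  have mono: "(f (z - r) < f z \<and> f z < f (z + r)) \<or> (f (z + r) < f z \<and> f z < f (z - r))"
    by (rule continuous_inj_imp_mono[OF _ _ _ injr])
       (use r in \<open>auto intro: continuous_on_subset[OF cont]\<close>)
  have no: "f y \<noteq> 0" if "z < y" "y \<le> x" for y
    using zmax[of y] that Suc.prems by (cases "y = x") auto
  have same: "f (z + r) > 0 \<longleftrightarrow> f x > 0"
  proof -
    have c: "continuous_on {z + r..x} f" by (rule continuous_on_subset[OF cont]) auto
    have "f w \<noteq> 0" if "z + r \<le> w" "w \<le> x" for w using no[of w] that r by auto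
    then show ?thesis
      using IVT'[of f "z+r" 0 x, OF _ _ _ c] IVT2'[of f x 0 "z+r", OF _ _ _ c] r
      by (metis linorder_not_le order_less_imp_le)
  qed
  have eqZ: "?Z x = insert z (?Z (z - r))"
  proof -
    have "y < z - r" if "f y = 0" "y < x" "y \<noteq> z" for y
    proof (rule ccontr)
      assume "\<not> y < z - r"
      then have "y \<in> {z - r..z + r}" using zmax[OF that(1,2)] r by auto
      then have "y = z" using inj_onD[OF injr, of y z] that(1) z(1) r by auto
      with that show False by simp
    qed
    then show ?thesis using z r by auto
  qed
  have "card (?Z x) = Suc (card (?Z (z - r)))"
    unfolding eqZ using fin' r by (subst card_insert_disjoint) auto
  then show ?case using Suc.hyps(1)[of "z - r"] Suc.hyps(2) mono same z(1) by auto
qed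

section \<open>Positions in sorted lists of finite sets\<close>

lemma sorted_list_of_set_strict_mono_image:
  fixes g :: "'a::linorder \<Rightarrow> 'b::linorder"
  assumes "finite A" "strict_mono_on A g"
  shows "sorted_list_of_set (g ` A) = map g (sorted_list_of_set A)"
proof (rule strict_sorted_equal)
  show "sorted_wrt (<) (map g (sorted_list_of_set A))"
    unfolding sorted_wrt_map
    by (rule sorted_wrt_mono_rel[OF _ strict_sorted_list_of_set])
       (use assms in \<open>simp add: strict_mono_onD\<close>)
qed (use assms in auto)

lemma sorted_list_of_set_consecutive:
  fixes A :: "'a::linorder set"
  assumes "finite A" and i: "Suc i < card A"
    and x: "sorted_list_of_set A ! i < x" "x < sorted_list_of_set A ! Suc i"
  shows "x \<notin> A" and "card {z \<in> A. z < x} = Suc i"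
proof -
  define xs where "xs = sorted_list_of_set A"
  have xs: "set xs = A" "length xs = card A" "distinct xs" "sorted_wrt (<) xs"
    using assms by (auto simp: xs_def)
  have nth: "xs ! j \<le> xs ! k" if "j \<le> k" "k < card A" for j k
    using sorted_wrt_nth_less[OF xs(4), of j k] that xs(2) by (cases "j = k") auto
  show "x \<notin> A"
  proof
    assume "x \<in> A"
    then obtain j where j: "j < card A" "x = xs ! j" by (metis xs(1,2) in_set_conv_nth)
    show False
      using nth[of j i] nth[of "Suc i" j] j x i unfolding xs_def[symmetric]
      by (cases "j \<le> i") auto
  qed
  have "{z \<in> A. z < x} = (!) xs ` {..i}"
  proof
    show "(!) xs ` {..i} \<subseteq> {z \<in> A. z < x}"
      using nth x i xs unfolding xs_def[symmetric] by fastforce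
    show "{z \<in> A. z < x} \<subseteq> (!) xs ` {..i}"
    proof
      fix z assume z: "z \<in> {z \<in> A. z < x}"
      then obtain j where j: "j < card A" "z = xs ! j" by (metis xs(1,2) in_set_conv_nth mem_Collect_eq)
      then have "j \<le> i"
        using nth[of "Suc i" j] z x unfolding xs_def[symmetric] by (cases "j \<le> i") auto
      with j show "z \<in> (!) xs ` {..i}" by auto
    qed
  qed
  moreover have "inj_on ((!) xs) {..i}" by (rule inj_on_nth) (use xs i in auto)
  ultimately show "card {z \<in> A. z < x} = Suc i" by (simp add: card_image)
qed

section \<open>Isolation and persistence of turning points\<close>

lemma locally_injective_of_deriv_nonzero:
  fixes v :: "real \<Rightarrow> real"
  assumes C1: "Ck_on 1 v UNIV" and nz: "deriv v a \<noteq> 0"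
  shows "\<exists>e>0. inj_on v {a - e..a + e}"
proof -
  have diff: "v field_differentiable at x" for x using C1 by (auto simp: Ck_on_def)
  have "continuous_on UNIV (deriv v)" 
  proof -
    have "continuous_on UNIV ((deriv ^^ 1) v)" using C1 unfolding Ck_on_def by blast
    then show ?thesis by simp
  qed
  then have "isCont (deriv v) a" by (simp add: continuous_on_eq_continuous_at)
  then obtain e where e: "e > 0" "\<And>x. \<bar>x - a\<bar> < e \<Longrightarrow> deriv v x \<noteq> 0"
    using continuous_at_avoid[of a "deriv v" 0] nz by (auto simp: dist_real_def abs_minus_commute)
  have neq: "v x \<noteq> v y" if "x < y" "\<bar>x - a\<bar> < e" "\<bar>y - a\<bar> < e" for x y
  proof
    assume "v x = v y"
    have "continuous_on {x..y} v"
      using diff by (meson continuous_at_imp_continuous_on field_differentiable_imp_continuous_at)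
    moreover have "(v has_derivative (*) (deriv v z)) (at z)" for z
      using field_differentiable_derivI[OF diff[of z]] by (simp add: has_field_derivative_def)
    ultimately have "\<exists>z. x < z \<and> z < y \<and> (*) (deriv v z) = (\<lambda>h. 0)"
      by (intro Rolle_deriv[OF \<open>x < y\<close> \<open>v x = v y\<close>])
    then obtain z where z: "x < z" "z < y" "(*) (deriv v z) = (\<lambda>h. 0)" by blast
    have "deriv v z = 0" using fun_cong[OF z(3), of 1] by simp
    with e(2)[of z] that z(1,2) show False by (auto simp: abs_less_iff)
  qed
  have "inj_on v {a - e/2..a + e/2}"
  proof (rule linorder_inj_onI')
    fix x y assume "x \<in> {a - e/2..a + e/2}" "y \<in> {a - e/2..a + e/2}" "x < y"
    then show "v x \<noteq> v y" using e(1) by (intro neq) auto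
  qed
  with e(1) show ?thesis by (intro exI[of _ "e/2"]) auto
qed

text \<open>
  The pair \<open>(r, d)\<close> is a quantitative form of ``finitely many simple turning points'': closed
  \<open>r\<close>-intervals around them are disjoint, \<open>v\<close> is injective on each, and outside their interiors
  \<open>v\<close> misses the energies closer than \<open>d\<close> to \<open>lam0\<close>.  Monotonicity on each interval
  is stated as injectivity so that rising and falling turning points need not be told apart.
\<close>
definition isolates_turning_points :: "(real \<Rightarrow> real) \<Rightarrow> real \<Rightarrow> real \<Rightarrow> real \<Rightarrow> bool" where
  "isolates_turning_points v lam0 r d \<longleftrightarrow> r > 0 \<and> d > 0 \<and>
     (\<forall>a\<in>turning_set v lam0. \<forall>b\<in>turning_set v lam0. a < b \<longrightarrow> a + r < b - r) \<and>
     (\<forall>a\<in>turning_set v lam0. inj_on v {a - r..a + r}) \<and>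
     (\<forall>x. (\<forall>a\<in>turning_set v lam0. r \<le> \<bar>x - a\<bar>) \<longrightarrow> d \<le> \<bar>v x - lam0\<bar>)"

lemma finite_common_radius:
  fixes P :: "'a \<Rightarrow> real \<Rightarrow> bool"
  assumes "finite A" "\<And>a. a \<in> A \<Longrightarrow> \<exists>r>0. P a r"
    and down: "\<And>a r s. \<lbrakk>P a r; 0 < s; s \<le> r\<rbrakk> \<Longrightarrow> P a s"
  shows "\<exists>r>0. \<forall>a\<in>A. P a r"
  using assms(1,2)
proof (induction A rule: finite_induct)
  case empty
  show ?case by (auto intro: exI[of _ 1])
next
  case (insert a A)
  obtain r where r: "r > 0" "\<forall>a\<in>A. P a r" using insert by auto
  obtain s where s: "s > 0" "P a s" using insert by auto
  show ?case
    using r s by (intro exI[of _ "min r s"]) (auto intro: down)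
qed

text \<open>
  The radius comes from finiteness and local injectivity.  For the energy gap \<open>d\<close>, the complement
  of the open \<open>r\<close>-intervals splits into a compact part, where \<open>\<bar>v - lam0\<bar>\<close> attains a positive
  minimum, and neighborhoods of \<open>\<plusminus>\<infinity>\<close>, where \<open>v\<close> exceeds \<open>m\<close>.
\<close>
lemma isolation_exists:
  fixes v :: "real \<Rightarrow> real"
  assumes C1: "Ck_on 1 v UNIV"
    and fin: "finite (turning_set v lam0)"
    and nz: "\<And>x. x \<in> turning_set v lam0 \<Longrightarrow> deriv v x \<noteq> 0"
    and m: "m > lam0" and top: "\<forall>\<^sub>F x in at_top. v x > m" and bot: "\<forall>\<^sub>F x in at_bot. v x > m"
  shows "\<exists>r d. isolates_turning_points v lam0 r d"
proof -
  let ?T = "turning_set v lam0"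
  have cont: "continuous_on UNIV v" 
  proof -
    have "continuous_on UNIV ((deriv ^^ 0) v)" using C1 unfolding Ck_on_def by blast
    then show ?thesis by simp
  qed
  obtain r1 where r1: "r1 > 0" "\<forall>a\<in>?T. inj_on v {a - r1..a + r1}"
  proof -
    have "\<exists>r>0. \<forall>a\<in>?T. inj_on v {a - r..a + r}"
    proof (rule finite_common_radius[OF fin])
      fix a r s :: real
      assume "inj_on v {a - r..a + r}" "s \<le> r"
      then show "inj_on v {a - s..a + s}" by (auto elim!: inj_on_subset)
    qed (rule locally_injective_of_deriv_nonzero[OF C1 nz])
    then show ?thesis using that by blast
  qed
  obtain r2 where r2: "r2 > 0" "\<forall>p\<in>?T \<times> ?T. fst p < snd p \<longrightarrow> fst p + r2 < snd p - r2"
  proof -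
    have "\<exists>r>0. \<forall>p\<in>?T \<times> ?T. fst p < snd p \<longrightarrow> fst p + r < snd p - (r::real)"
    proof (rule finite_common_radius)
      fix p :: "real \<times> real"
      show "\<exists>r>0. fst p < snd p \<longrightarrow> fst p + r < snd p - r"
        by (intro exI[of _ "if fst p < snd p then (snd p - fst p) / 3 else 1"]) (auto simp: field_simps)
    qed (use fin in auto)
    then show ?thesis using that by blast
  qed
  define r where "r = min r1 r2"
  have r: "r > 0" using r1 r2 by (simp add: r_def)
  obtain B1 B2 where B: "\<And>x. x \<ge> B1 \<Longrightarrow> v x > m" "\<And>x. x \<le> B2 \<Longrightarrow> v x > m"
    using top bot unfolding eventually_at_top_linorder eventually_at_bot_linorder by blast
  define K where "K = {B2..B1} - (\<Union>a\<in>?T. ball a r)"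
  have "compact K" unfolding K_def by (intro compact_diff) auto
  have pos: "\<bar>v x - lam0\<bar> > 0" if "x \<in> K" for x
    using that r by (auto simp: K_def turning_set_def)
  obtain d1 where d1: "d1 > 0" "\<And>x. x \<in> K \<Longrightarrow> d1 \<le> \<bar>v x - lam0\<bar>"
  proof (cases "K = {}")
    case True
    then show ?thesis using that[of 1] by auto
  next
    case False
    have "continuous_on K (\<lambda>x. \<bar>v x - lam0\<bar>)"
      by (intro continuous_intros continuous_on_subset[OF cont]) auto
    from continuous_attains_inf[OF \<open>compact K\<close> False this] obtain y
      where "y \<in> K" "\<forall>x\<in>K. \<bar>v y - lam0\<bar> \<le> \<bar>v x - lam0\<bar>" by blast
    then show ?thesis using that[of "\<bar>v y - lam0\<bar>"] pos by blast
  qed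
  have "min d1 (m - lam0) \<le> \<bar>v x - lam0\<bar>" if "\<forall>a\<in>?T. r \<le> \<bar>x - a\<bar>" for x
  proof (cases "x \<in> {B2..B1}")
    case True
    with that have "x \<in> K" by (force simp: K_def dist_real_def)
    with d1(2)[of x] show ?thesis by auto
  next
    case False
    then have "v x > m" using B by force
    then show ?thesis by auto
  qed
  moreover have "inj_on v {a - r..a + r}" if "a \<in> ?T" for a
    by (rule inj_on_subset[OF bspec[OF r1(2) that]]) (auto simp: r_def)
  moreover have "a + r < b - r" if "a \<in> ?T" "b \<in> ?T" "a < b" for a b
  proof -
    have "a + r2 < b - r2" using r2(2) that by auto
    then show ?thesis by (auto simp: r_def)
  qed
  ultimately have "isolates_turning_points v lam0 r (min d1 (m - lam0))"
    unfolding isolates_turning_points_def using r d1(1) m by auto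
  then show ?thesis by blast
qed

text \<open>
  The interval ends are at distance at least \<open>r\<close> from every turning point because distinct
  intervals are disjoint, so the energy gap applies to them.
\<close>
lemma isolates_turning_points_boundary:
  assumes iso: "isolates_turning_points v lam0 r d" and a: "a \<in> turning_set v lam0"
  shows "d \<le> \<bar>v (a - r) - lam0\<bar>" and "d \<le> \<bar>v (a + r) - lam0\<bar>"
proof -
  note I = iso[unfolded isolates_turning_points_def]
  have sep: "r \<le> \<bar>a - r - b\<bar> \<and> r \<le> \<bar>a + r - b\<bar>" if b: "b \<in> turning_set v lam0" for b
  proof (cases a b rule: linorder_cases)
    case less
    then have "a + r < b - r" using I a b by blast
    then show ?thesis using I by auto
  next
    case equal
    then show ?thesis by auto
  next
    case greater
    then have "b + r < a - r" using I a b by blast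
    then show ?thesis using I by auto
  qed
  then show "d \<le> \<bar>v (a - r) - lam0\<bar>" and "d \<le> \<bar>v (a + r) - lam0\<bar>" using I by blast+
qed

text \<open>
  On each isolating interval \<open>v\<close> is strictly monotone and crosses from one side of
  \<open>(lam0 - d, lam0 + d)\<close> to the other, so it takes the value \<open>lam\<close> exactly once there, and it does
  not take it elsewhere.  This gives a bijection between the two sets of turning points, which is
  increasing since the intervals are disjoint; it therefore matches list positions.
\<close>
lemma turning_points_persist:
  fixes v :: "real \<Rightarrow> real"
  assumes cont: "continuous_on UNIV v" and fin: "finite (turning_set v lam0)"
    and iso: "isolates_turning_points v lam0 r d"
    and lam: "\<bar>lam - lam0\<bar> < d" and i: "i < card (turning_set v lam0)"
  shows "\<bar>sorted_list_of_set (turning_set v lam) ! i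
           - sorted_list_of_set (turning_set v lam0) ! i\<bar> < r"
    and "finite (turning_set v lam)"
    and "card (turning_set v lam) = card (turning_set v lam0)"
proof -
  let ?T = "turning_set v lam0"
  note I = iso[unfolded isolates_turning_points_def]
  note ends = isolates_turning_points_boundary[OF iso]
  have "\<exists>y. \<bar>y - a\<bar> < r \<and> v y = lam" if a: "a \<in> ?T" for a
  proof -
    have va: "v a = lam0" using a by (simp add: turning_set_def)
    have c: "continuous_on {a - r..a + r} v" by (rule continuous_on_subset[OF cont]) auto
    have "(v (a - r) < v a \<and> v a < v (a + r)) \<or> (v (a + r) < v a \<and> v a < v (a - r))"
      using I a c by (intro continuous_inj_imp_mono) auto
    then have "\<exists>y. a - r \<le> y \<and> y \<le> a + r \<and> v y = lam"
      using IVT'[of v "a-r" lam "a+r", OF _ _ _ c] IVT2'[of v "a+r" lam "a-r", OF _ _ _ c]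
        ends[OF a] va lam I by (elim disjE) auto
    then obtain y where y: "a - r \<le> y" "y \<le> a + r" "v y = lam" by blast
    then have "y \<noteq> a - r" "y \<noteq> a + r" using ends[OF a] lam by auto
    with y show ?thesis by (intro exI[of _ y]) auto
  qed
  then obtain g where g: "\<And>a. a \<in> ?T \<Longrightarrow> \<bar>g a - a\<bar> < r" "\<And>a. a \<in> ?T \<Longrightarrow> v (g a) = lam"
    by metis
  have mono: "strict_mono_on ?T g"
  proof (rule strict_mono_onI)
    fix a b assume ab: "a \<in> ?T" "b \<in> ?T" "a < b"
    then have "a + r < b - r" using I by blast
    then show "g a < g b" using g(1)[OF ab(1)] g(1)[OF ab(2)] by auto
  qed
  have img: "turning_set v lam = g ` ?T"
  proof
    show "g ` ?T \<subseteq> turning_set v lam" using g by (auto simp: turning_set_def)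
    show "turning_set v lam \<subseteq> g ` ?T"
    proof
      fix x assume "x \<in> turning_set v lam"
      then have x: "v x = lam" by (simp add: turning_set_def)
      then have "\<not> d \<le> \<bar>v x - lam0\<bar>" using lam by auto
      then obtain a where a: "a \<in> ?T" "\<bar>x - a\<bar> < r" using I by (meson not_le)
      have "inj_on v {a - r..a + r}" using I a by blast
      then have "x = g a" by (rule inj_onD) (use x g[OF a(1)] a(2) in auto)
      with a show "x \<in> g ` ?T" by blast
    qed
  qed
  show "finite (turning_set v lam)" using fin img by simp
  show "card (turning_set v lam) = card (turning_set v lam0)"
    unfolding img by (rule card_image) (rule strict_mono_on_imp_inj_on[OF mono])
  have "sorted_list_of_set ?T ! i \<in> ?T"
    using fin i by (metis nth_mem set_sorted_list_of_set length_sorted_list_of_set)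
  then show "\<bar>sorted_list_of_set (turning_set v lam) ! i - sorted_list_of_set ?T ! i\<bar> < r"
    unfolding img sorted_list_of_set_strict_mono_image[OF fin mono] using i fin
    by (simp add: g)
qed

section \<open>Wells\<close>

text \<open>
  The fixed interval \<open>[\<alpha>, \<beta>]\<close> is the gap between two consecutive turning points at energy \<open>lam0\<close>,
  shortened by \<open>r\<close> at both ends.  List positions start at \<open>0\<close>, so to the right of an even position
  \<open>i\<close> an odd number of sign changes has occurred and \<open>v < lam0\<close>.  At \<open>\<alpha>\<close> the energy gap improves
  this to \<open>v \<alpha> \<le> lam0 - d\<close>, which lies below every nearby energy; thus \<open>v < lam\<close> at one point of
  the gap at energy \<open>lam\<close>, and on all of it since there is no turning point inside.
\<close>
lemma wells_near_reference_energy: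
  fixes v :: "real \<Rightarrow> real"
  assumes cont: "continuous_on UNIV v" and fin: "finite (turning_set v lam0)"
    and iso: "isolates_turning_points v lam0 r d"
    and bot: "\<forall>\<^sub>F x in at_bot. v x > lam0"
    and i: "even i" "Suc i < card (turning_set v lam0)"
  shows "\<exists>\<alpha> \<beta>. \<alpha> < \<beta> \<and> (\<forall>lam. \<bar>lam - lam0\<bar> < d \<longrightarrow>
    (let p = sorted_list_of_set (turning_set v lam) ! i;
         q = sorted_list_of_set (turning_set v lam) ! Suc i
     in p < \<alpha> \<and> \<beta> < q \<and> v p = lam \<and> v q = lam \<and> (\<forall>x. p < x \<and> x < q \<longrightarrow> v x < lam)))"
proof -
  let ?T = "turning_set v lam0"
  note I = iso[unfolded isolates_turning_points_def]
  let ?a = "\<lambda>lam. (!) (sorted_list_of_set (turning_set v lam))"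
  have mem: "?a lam k \<in> turning_set v lam" if "finite (turning_set v lam)" "k < card (turning_set v lam)" for lam k
    using that by (metis nth_mem set_sorted_list_of_set length_sorted_list_of_set)
  have aT: "?a lam0 i \<in> ?T" "?a lam0 (Suc i) \<in> ?T" using mem fin i by auto
  have "?a lam0 i < ?a lam0 (Suc i)"
    using sorted_wrt_nth_less[OF strict_sorted_list_of_set, of i "Suc i" ?T] i fin by simp
  with aT I have gap: "?a lam0 i + r < ?a lam0 (Suc i) - r" by blast
  let ?\<alpha> = "?a lam0 i + r" and ?\<beta> = "?a lam0 (Suc i) - r"
  have "v ?\<alpha> < lam0"
  proof -
    have bw: "?a lam0 i < ?\<alpha>" "?\<alpha> < ?a lam0 (Suc i)" using gap I by auto
    note c = sorted_list_of_set_consecutive[OF fin i(2) bw]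
    have "v ?\<alpha> - lam0 > 0 \<longleftrightarrow> even (card {z. v z - lam0 = 0 \<and> z < ?\<alpha>})"
    proof (rule sign_eq_parity_of_zeros_below)
      show "finite {z. v z - lam0 = 0}" using fin by (simp add: turning_set_def)
      show "\<forall>\<^sub>F x in at_bot. v x - lam0 > 0" using bot by simp
      show "v ?\<alpha> - lam0 \<noteq> 0" using c(1) by (simp add: turning_set_def)
      fix z assume "v z - lam0 = 0"
      then have "z \<in> ?T" by (simp add: turning_set_def)
      then have "r > 0" and inj: "inj_on v {z - r..z + r}" using I by blast+
      have "inj_on (\<lambda>x. v x - lam0) {z - r..z + r}"
        by (rule inj_onI, rule inj_onD[OF inj]) simp_all
      with \<open>r > 0\<close> show "\<exists>r>0. inj_on (\<lambda>x. v x - lam0) {z - r..z + r}" by blast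
    qed (intro continuous_intros cont)
    moreover have "{z. v z - lam0 = 0 \<and> z < ?\<alpha>} = {z \<in> ?T. z < ?\<alpha>}"
      by (auto simp: turning_set_def)
    ultimately have "\<not> v ?\<alpha> > lam0" using c(2) i(1) by simp
    moreover have "v ?\<alpha> \<noteq> lam0" using c(1) by (simp add: turning_set_def)
    ultimately show ?thesis by simp
  qed
  with isolates_turning_points_boundary(2)[OF iso aT(1)] have deep: "v ?\<alpha> \<le> lam0 - d" by auto
  have "let p = ?a lam i; q = ?a lam (Suc i)
     in p < ?\<alpha> \<and> ?\<beta> < q \<and> v p = lam \<and> v q = lam \<and> (\<forall>x. p < x \<and> x < q \<longrightarrow> v x < lam)"
    if lam: "\<bar>lam - lam0\<bar> < d" for lam
  proof -
    have i': "i < card ?T" using i by simp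
    note P = turning_points_persist[OF cont fin iso lam]
    note fin' = P(2)[OF i'] and card' = P(3)[OF i']
    have pq: "?a lam i < ?\<alpha>" "?\<beta> < ?a lam (Suc i)" using P(1)[OF i'] P(1)[OF i(2)] by auto
    have vpq: "v (?a lam i) = lam" "v (?a lam (Suc i)) = lam"
      using mem[OF fin', of i] mem[OF fin', of "Suc i"] i card' by (auto simp: turning_set_def)
    have "v x < lam" if x: "?a lam i < x" "x < ?a lam (Suc i)" for x
    proof (rule ccontr)
      assume "\<not> v x < lam"
      then have "lam \<le> v x" "v ?\<alpha> \<le> lam" using deep lam by auto
      moreover have "continuous_on {x..?\<alpha>} v" "continuous_on {?\<alpha>..x} v"
        using continuous_on_subset[OF cont] by auto
      ultimately obtain z where z: "min x ?\<alpha> \<le> z" "z \<le> max x ?\<alpha>" "v z = lam"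
        using IVT'[of v ?\<alpha> lam x] IVT2'[of v ?\<alpha> lam x] by (cases "x \<le> ?\<alpha>") (auto simp: min_def max_def)
      then have "?a lam i < z" "z < ?a lam (Suc i)" using x pq gap by auto
      with sorted_list_of_set_consecutive(1)[OF fin'] i card' have "z \<notin> turning_set v lam" by metis
      with z show False by (simp add: turning_set_def)
    qed
    with pq vpq show ?thesis by (simp add: Let_def)
  qed
  with gap show ?thesis by blast
qed

section \<open>Growth of the action\<close>

lemma interval_integral_powr_half_eq_integral_sqrt:
  fixes v :: "real \<Rightarrow> real"
  assumes cont: "continuous_on {a..b} v" and "a \<le> b" and le: "\<And>x. x \<in> {a..b} \<Longrightarrow> v x \<le> lam"
  shows "(LBINT x=ereal a..ereal b. (lam - v x) powr (1/2)) = integral {a..b} (\<lambda>x. sqrt (lam - v x))"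
proof -
  have "continuous_on {a..b} (\<lambda>x. (lam - v x) powr (1/2))"
    by (intro continuous_on_powr' continuous_intros cont) (use le in auto)
  then have "set_integrable lborel {a..b} (\<lambda>x. (lam - v x) powr (1/2))"
    by (rule borel_integrable_atLeastAtMost')
  then have "(LBINT x=ereal a..ereal b. (lam - v x) powr (1/2)) = integral {a..b} (\<lambda>x. (lam - v x) powr (1/2))"
    by (rule interval_integral_eq_integral[OF \<open>a \<le> b\<close>])
  also have "\<dots> = integral {a..b} (\<lambda>x. sqrt (lam - v x))"
    by (rule integral_cong) (simp add: powr_half_sqrt le)
  finally show ?thesis .
qed

lemma sqrt_diff_ge:
  fixes s t B :: real
  assumes "0 \<le> s" "s < t" "t \<le> B"
  shows "(t - s) / (2 * sqrt B) \<le> sqrt t - sqrt s"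
proof -
  have "t - s = (sqrt t - sqrt s) * (sqrt t + sqrt s)"
    using assms by (simp add: algebra_simps)
  also have "\<dots> \<le> (sqrt t - sqrt s) * (2 * sqrt B)"
  proof (rule mult_left_mono)
    have "sqrt t \<le> sqrt B" "sqrt s \<le> sqrt B" using assms by simp_all
    then show "sqrt t + sqrt s \<le> 2 * sqrt B" by linarith
  qed (use assms in simp)
  finally show ?thesis using assms by (simp add: field_simps)
qed

text \<open>
  Enlarging the well only adds a nonnegative integral; on the smaller well the integrands are
  ordered, so it may be shrunk to \<open>[\<alpha>, \<beta>]\<close>, where the concavity bound for the square root is
  uniform.  In this way the endpoints, where the derivative of the integrand in the energy is
  singular, never enter.
\<close>
lemma action_difference_ge:
  fixes v :: "real \<Rightarrow> real"
  assumes cont: "continuous_on UNIV v" and "lam < mu"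
    and order: "p' \<le> p" "p < \<alpha>" "\<alpha> < \<beta>" "\<beta> < q" "q \<le> q'"
    and lam: "\<And>x. x \<in> {p..q} \<Longrightarrow> v x \<le> lam" and mu: "\<And>x. x \<in> {p'..q'} \<Longrightarrow> v x \<le> mu"
    and B: "\<And>x. x \<in> {\<alpha>..\<beta>} \<Longrightarrow> mu - v x \<le> B"
  shows "(\<beta> - \<alpha>) / (2 * sqrt B) * (mu - lam)
    \<le> (LBINT x=ereal p'..ereal q'. (mu - v x) powr (1/2)) - (LBINT x=ereal p..ereal q. (lam - v x) powr (1/2))"
proof -
  let ?g = "\<lambda>lam x. sqrt (lam - v x)"
  have int: "?g c integrable_on {a..b}" for a b c
    by (intro integrable_continuous_real continuous_intros continuous_on_subset[OF cont]) auto
  have cs: "continuous_on S v" for S by (rule continuous_on_subset[OF cont]) auto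
  have dint: "(\<lambda>x. ?g mu x - ?g lam x) integrable_on {a..b}" for a b by (intro integrable_diff int)
  have "(\<beta> - \<alpha>) / (2 * sqrt B) * (mu - lam) = integral {\<alpha>..\<beta>} (\<lambda>x. (mu - lam) / (2 * sqrt B))"
    using order by simp
  also have "\<dots> \<le> integral {\<alpha>..\<beta>} (\<lambda>x. ?g mu x - ?g lam x)"
  proof (rule integral_le)
    fix x assume x: "x \<in> {\<alpha>..\<beta>}"
    show "(mu - lam) / (2 * sqrt B) \<le> ?g mu x - ?g lam x"
      using sqrt_diff_ge[of "lam - v x" "mu - v x" B] lam[of x] B[OF x] x order \<open>lam < mu\<close> by auto
  qed (use dint in auto)
  also have "\<dots> \<le> integral {p..q} (\<lambda>x. ?g mu x - ?g lam x)"
    by (rule integral_subset_le) (use dint order \<open>lam < mu\<close> in auto)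
  also have "\<dots> = integral {p..q} (?g mu) - integral {p..q} (?g lam)"
    by (intro integral_diff int)
  also have "integral {p..q} (?g mu) \<le> integral {p'..q'} (?g mu)"
    by (rule integral_subset_le) (use int order mu in auto)
  finally show ?thesis
    using interval_integral_powr_half_eq_integral_sqrt[OF cs, of p q lam]
      interval_integral_powr_half_eq_integral_sqrt[OF cs, of p' q' mu] order lam mu by auto
qed

text \<open>
  In terms of difference quotients, \<open>\<Phi>'\<close> is bounded below by a positive constant near \<open>lam0\<close>.
  The rate is uniform because all the wells contain the same \<open>[\<alpha>, \<beta>]\<close>,
  where \<open>mu - v\<close> is bounded by a constant \<open>B\<close> for all energies within \<open>d\<close> of \<open>lam0\<close>.
\<close>
lemma Phi_expanding:
  fixes v :: "real \<Rightarrow> real"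
  assumes cont: "continuous_on UNIV v" and fin: "finite (turning_set v lam0)"
    and iso: "isolates_turning_points v lam0 r d"
    and bot: "\<forall>\<^sub>F x in at_bot. v x > lam0"
    and l: "l \<in> {1..num_wells v lam0}"
  shows "\<exists>\<kappa>>0. \<forall>lam mu. \<bar>lam - lam0\<bar> < d \<longrightarrow> \<bar>mu - lam0\<bar> < d \<longrightarrow> lam < mu \<longrightarrow>
    \<kappa> * (mu - lam) \<le> Phi v l mu - Phi v l lam"
proof -
  let ?i = "2 * l - 2"
  have i: "even ?i" "Suc ?i < card (turning_set v lam0)" and Suc_i: "2 * l - 1 = Suc ?i"
    using l by (auto simp: num_wells_def)
  obtain \<alpha> \<beta> where ab: "\<alpha> < \<beta>" and well: "\<And>lam. \<bar>lam - lam0\<bar> < d \<Longrightarrow>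
      x_minus v l lam < \<alpha> \<and> \<beta> < x_plus v l lam \<and> v (x_minus v l lam) = lam \<and> v (x_plus v l lam) = lam \<and>
      (\<forall>x. x_minus v l lam < x \<and> x < x_plus v l lam \<longrightarrow> v x < lam)"
    using wells_near_reference_energy[OF cont fin iso bot i]
    unfolding x_minus_def x_plus_def Suc_i Let_def by blast
  have "compact (v ` {\<alpha>..\<beta>})"
    by (intro compact_continuous_image continuous_on_subset[OF cont]) auto
  then obtain m where m: "\<And>x. x \<in> {\<alpha>..\<beta>} \<Longrightarrow> \<bar>v x\<bar> \<le> m"
    using compact_imp_bounded bounded_iff by (metis imageI real_norm_def)
  define B where "B = \<bar>lam0\<bar> + d + m"
  have "d > 0" using iso by (simp add: isolates_turning_points_def)
  have "B > 0" using m[of \<alpha>] ab \<open>d > 0\<close> by (auto simp: B_def)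
  have "(\<beta> - \<alpha>) / (2 * sqrt B) * (mu - lam) \<le> Phi v l mu - Phi v l lam"
    if lam: "\<bar>lam - lam0\<bar> < d" and mu: "\<bar>mu - lam0\<bar> < d" and "lam < mu" for lam mu
    unfolding Phi_def
  proof (rule action_difference_ge[OF cont \<open>lam < mu\<close>])
    note L = well[OF lam] and M = well[OF mu]
    have below: "v x \<le> lam" if "x \<in> {x_minus v l lam..x_plus v l lam}" for x
      using that L by (cases "x = x_minus v l lam \<or> x = x_plus v l lam") (auto simp: less_le)
    show "v x \<le> lam" if "x \<in> {x_minus v l lam..x_plus v l lam}" for x
      using below[OF that] .
    show "v x \<le> mu" if "x \<in> {x_minus v l mu..x_plus v l mu}" for x
      using that M by (cases "x = x_minus v l mu \<or> x = x_plus v l mu") (auto simp: less_le)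
    \<comment> \<open>An endpoint of the larger well inside the smaller one would carry the value \<open>mu\<close> where
        \<open>v \<le> lam\<close>; both wells contain \<open>[\<alpha>, \<beta>]\<close>, so the endpoints cannot pass each other.\<close>
    show "x_minus v l mu \<le> x_minus v l lam"
      using below[of "x_minus v l mu"] L M ab \<open>lam < mu\<close> by force
    show "x_plus v l lam \<le> x_plus v l mu"
      using below[of "x_plus v l mu"] L M ab \<open>lam < mu\<close> by force
    show "x_minus v l lam < \<alpha>" "\<alpha> < \<beta>" "\<beta> < x_plus v l lam" using L ab by auto
    show "mu - v x \<le> B" if "x \<in> {\<alpha>..\<beta>}" for x
      using m[OF that] mu by (auto simp: B_def)
  qed
  moreover have "(\<beta> - \<alpha>) / (2 * sqrt B) > 0" using ab \<open>B > 0\<close> by simp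
  ultimately show ?thesis by blast
qed

section \<open>Uniqueness of the quantized energy\<close>

text \<open>
  The radius \<open>1\<close> is chosen as a convenient bound below \<open>\<pi>/3\<close>, the distance from a zero of the
  cosine within which its slope is at least \<open>1/2\<close> in absolute value.
\<close>
lemma cos_expanding_near_half_integer:
  fixes s t :: real and n :: int
  assumes "\<bar>s - pi * (of_int n + 1/2)\<bar> \<le> 1" "\<bar>t - pi * (of_int n + 1/2)\<bar> \<le> 1" "s < t"
  shows "(t - s) / 2 \<le> \<bar>cos t - cos s\<bar>"
proof -
  obtain z where z: "s < z" "z < t" "cos t - cos s = (t - s) * (- sin z)"
    using MVT2[OF \<open>s < t\<close>, of cos "\<lambda>z. - sin z"] by (auto intro!: derivative_eq_intros)
  define u where "u = z - pi * (of_int n + 1/2)"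
  have u: "\<bar>u\<bar> \<le> 1" using assms z by (auto simp: u_def)
  have "z = (u + pi / 2) + pi * of_int n" by (simp add: u_def algebra_simps)
  then have "sin z = sin (u + pi / 2) * cos (pi * of_int n)"
    by (simp add: sin_add[of "u + pi / 2"] del: sin_cos_eq)
  then have "\<bar>sin z\<bar> = \<bar>cos u\<bar>"
    by (simp add: sin_add abs_mult)
  moreover have "1/2 \<le> cos u"
  proof -
    have "cos (pi / 3) \<le> cos \<bar>u\<bar>"
      using u pi_gt3 by (intro cos_monotone_0_pi_le) auto
    then show ?thesis by (simp add: cos_60)
  qed
  ultimately have "1/2 \<le> \<bar>sin z\<bar>" by simp
  then have "(t - s) * (1/2) \<le> (t - s) * \<bar>sin z\<bar>" using \<open>s < t\<close> by (intro mult_left_mono) auto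
  then show ?thesis using z \<open>s < t\<close> by (simp add: abs_mult)
qed

text \<open>
  The condition \<open>C h \<le> 1\<close> keeps the phases in the range of the previous lemma, and the constant
  \<open>\<kappa> / 4\<close> makes the slope of the error strictly smaller than the slope \<open>\<kappa> / (2 h)\<close> guaranteed for
  the cosine.
\<close>
lemma quantized_energy_unique:
  fixes F e :: "real \<Rightarrow> real" and n :: int
  assumes h: "h > 0" and "\<kappa> > 0" and "C * h \<le> 1"
    and F: "\<And>lam mu. \<lbrakk>lam \<in> {a<..<b}; mu \<in> {a<..<b}; lam < mu\<rbrakk> \<Longrightarrow> \<kappa> * (mu - lam) \<le> F mu - F lam"
    and e: "\<And>lam. lam \<in> {a<..<b} \<Longrightarrow> e field_differentiable at lam"
      "\<And>lam. lam \<in> {a<..<b} \<Longrightarrow> \<bar>deriv e lam\<bar> \<le> \<kappa> / 4 / h"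
  shows "\<exists>\<^sub>\<le>\<^sub>1 lam. lam \<in> {a<..<b} \<and> cos (F lam / h) + e lam = 0 \<and>
     \<bar>F lam - pi * (of_int n + 1/2) * h\<bar> \<le> C * h\<^sup>2"
proof -
  let ?P = "\<lambda>lam. lam \<in> {a<..<b} \<and> cos (F lam / h) + e lam = 0 \<and>
     \<bar>F lam - pi * (of_int n + 1/2) * h\<bar> \<le> C * h\<^sup>2"
  have False if P: "?P lam" "?P mu" and "lam < mu" for lam mu
  proof -
    have near: "\<bar>F x / h - pi * (of_int n + 1/2)\<bar> \<le> 1" if "?P x" for x
    proof -
      have "\<bar>F x / h - pi * (of_int n + 1/2)\<bar> = \<bar>F x - pi * (of_int n + 1/2) * h\<bar> / h"
    proof -
      have "F x / h - pi * (of_int n + 1/2) = (F x - pi * (of_int n + 1/2) * h) / h"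
        using h by (simp add: field_simps)
      then show ?thesis using h by (simp only: abs_divide)
    qed
      also have "\<dots> \<le> C * h\<^sup>2 / h" using that h by (intro divide_right_mono) auto
      also have "\<dots> = C * h" using h by (simp add: power2_eq_square)
      finally show ?thesis using \<open>C * h \<le> 1\<close> by simp
    qed
    have FF: "\<kappa> * (mu - lam) \<le> F mu - F lam" using F P \<open>lam < mu\<close> by blast
    have pos: "\<kappa> * (mu - lam) > 0" using \<open>\<kappa> > 0\<close> \<open>lam < mu\<close> by simp
    have "\<kappa> * (mu - lam) / h / 2 \<le> (F mu / h - F lam / h) / 2"
      using FF h by (simp add: divide_right_mono flip: diff_divide_distrib)
    also have "\<dots> \<le> \<bar>cos (F mu / h) - cos (F lam / h)\<bar>"
      using FF pos h near[OF P(1)] near[OF P(2)]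
      by (intro cos_expanding_near_half_integer[of _ n]) (auto simp: divide_strict_right_mono)
    also have "cos (F mu / h) - cos (F lam / h) = - (e mu - e lam)" using P by auto
    also have "\<bar>- (e mu - e lam)\<bar> \<le> \<kappa> / 4 / h * (mu - lam)"
    proof -
      obtain z where z: "lam < z" "z < mu" "e mu - e lam = (mu - lam) * deriv e z"
        using MVT2[OF \<open>lam < mu\<close>, of e "deriv e"] e(1) P
        by (auto simp: field_differentiable_derivI)
      then have bound: "\<bar>deriv e z\<bar> \<le> \<kappa> / 4 / h" using e(2)[of z] P by auto
      have "\<bar>- (e mu - e lam)\<bar> = \<bar>deriv e z\<bar> * (mu - lam)"
        unfolding abs_minus_cancel z(3) using \<open>lam < mu\<close> by (simp add: abs_mult)
      also have "\<dots> \<le> \<kappa> / 4 / h * (mu - lam)"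
        using bound \<open>lam < mu\<close> by (intro mult_right_mono) auto
      finally show ?thesis .
    qed
    finally have "\<kappa> * (mu - lam) / h / 2 \<le> \<kappa> / 4 / h * (mu - lam)" .
    moreover define X where "X = \<kappa> * (mu - lam) / h"
    moreover have "\<kappa> / 4 / h * (mu - lam) = X / 4" by (simp add: X_def)
    moreover have "X > 0" using pos h by (simp add: X_def)
    ultimately show False by simp
  qed
  then show ?thesis unfolding Uniq_def by (metis linorder_neqE)
qed

theorem theorem6p3:
  fixes v :: "real \<Rightarrow> real" and lam0 :: real
  assumes "standing_assumptions v lam0"
  shows "\<exists>\<delta>>0. \<forall>\<Lambda>1 \<Lambda>2.
    lam0 - \<delta> < \<Lambda>1 \<and> \<Lambda>1 < lam0 \<and> lam0 < \<Lambda>2 \<and> \<Lambda>2 < lam0 + \<delta> \<longrightarrow>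
    (\<forall>l\<in>{1..num_wells v lam0}. \<forall>eps :: real \<Rightarrow> real \<Rightarrow> real.
      admissible_error {\<Lambda>1<..<\<Lambda>2} eps \<longrightarrow>
      (\<forall>C>0. \<exists>h0>0. \<forall>h. 0 < h \<and> h < h0 \<longrightarrow>
        (\<forall>n::int. pi * (of_int n + 1/2) * h \<in> Phi v l ` {\<Lambda>1<..<\<Lambda>2} \<longrightarrow>
          (\<exists>\<^sub>\<le>\<^sub>1 lam. lam \<in> {\<Lambda>1<..<\<Lambda>2} \<and>
             cos (Phi v l lam / h) + eps lam h = 0 \<and>
             \<bar>Phi v l lam - pi * (of_int n + 1/2) * h\<bar> \<le> C * h\<^sup>2))))"
proof -
  note S = assms[unfolded standing_assumptions_def]
  have C2: "Ck_on 2 v UNIV" and fin: "finite (turning_set v lam0)"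
    and nz: "\<And>x. x \<in> turning_set v lam0 \<Longrightarrow> deriv v x \<noteq> 0"
    and top: "ereal lam0 < Liminf at_top (\<lambda>x. ereal (v x))"
    and bot: "ereal lam0 < Liminf at_bot (\<lambda>x. ereal (v x))"
    using S by blast+
  have C1: "Ck_on 1 v UNIV" using C2 unfolding Ck_on_def by (meson le_trans less_le_trans one_le_numeral)
  have "continuous_on UNIV ((deriv ^^ 0) v)" using C1 unfolding Ck_on_def by blast
  then have cont: "continuous_on UNIV v" by simp
  obtain m where m: "ereal lam0 < ereal m"
      "ereal m < min (Liminf at_top (\<lambda>x. ereal (v x))) (Liminf at_bot (\<lambda>x. ereal (v x)))"
    using ereal_dense2[of "ereal lam0"] top bot by (metis min_less_iff_conj)
  have evm: "\<forall>\<^sub>F x in at_top. v x > m" "\<forall>\<^sub>F x in at_bot. v x > m"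
    using less_LiminfD[of "ereal m" at_top "\<lambda>x. ereal (v x)"]
      less_LiminfD[of "ereal m" at_bot "\<lambda>x. ereal (v x)"] m(2) by auto
  obtain r d where iso: "isolates_turning_points v lam0 r d"
    using isolation_exists[OF C1 fin nz _ evm] m(1) by auto
  have "d > 0" using iso by (simp add: isolates_turning_points_def)
  have evbot: "\<forall>\<^sub>F x in at_bot. v x > lam0" using evm(2) m(1) by (auto elim: eventually_mono)
  show ?thesis
  proof (rule exI[of _ d], intro conjI allI impI ballI \<open>d > 0\<close>)
    fix \<Lambda>1 \<Lambda>2 l C and eps :: "real \<Rightarrow> real \<Rightarrow> real"
    assume \<Lambda>: "lam0 - d < \<Lambda>1 \<and> \<Lambda>1 < lam0 \<and> lam0 < \<Lambda>2 \<and> \<Lambda>2 < lam0 + d"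
      and l: "l \<in> {1..num_wells v lam0}"
      and adm: "admissible_error {\<Lambda>1<..<\<Lambda>2} eps" and C: "(C::real) > 0"
    obtain \<kappa> where \<kappa>: "\<kappa> > 0" "\<And>lam mu. \<lbrakk>\<bar>lam - lam0\<bar> < d; \<bar>mu - lam0\<bar> < d; lam < mu\<rbrakk> \<Longrightarrow>
        \<kappa> * (mu - lam) \<le> Phi v l mu - Phi v l lam"
      using Phi_expanding[OF cont fin iso evbot l] by blast
    have "\<kappa> / 4 > 0" using \<kappa> by simp
    with adm have "\<forall>\<^sub>F h in at_right 0. Ck_on 1 (\<lambda>lam. eps lam h) {\<Lambda>1<..<\<Lambda>2} \<and>
        (\<forall>lam\<in>{\<Lambda>1<..<\<Lambda>2}. \<bar>deriv (\<lambda>mu. eps mu h) lam\<bar> \<le> \<kappa> / 4 / h)"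
      unfolding admissible_error_def by (intro eventually_conj) blast+
    then obtain h1 where h1: "h1 > 0" "\<And>h. \<lbrakk>0 < h; h < h1\<rbrakk> \<Longrightarrow> Ck_on 1 (\<lambda>lam. eps lam h) {\<Lambda>1<..<\<Lambda>2} \<and>
        (\<forall>lam\<in>{\<Lambda>1<..<\<Lambda>2}. \<bar>deriv (\<lambda>mu. eps mu h) lam\<bar> \<le> \<kappa> / 4 / h)"
      unfolding eventually_at_right_field by blast
    show "\<exists>h0>0. \<forall>h. 0 < h \<and> h < h0 \<longrightarrow>
        (\<forall>n::int. pi * (of_int n + 1/2) * h \<in> Phi v l ` {\<Lambda>1<..<\<Lambda>2} \<longrightarrow>
          (\<exists>\<^sub>\<le>\<^sub>1 lam. lam \<in> {\<Lambda>1<..<\<Lambda>2} \<and>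
             cos (Phi v l lam / h) + eps lam h = 0 \<and>
             \<bar>Phi v l lam - pi * (of_int n + 1/2) * h\<bar> \<le> C * h\<^sup>2))"
    proof (intro exI[of _ "min h1 (1 / C)"] conjI allI impI)
      show "min h1 (1 / C) > 0" using h1 C by simp
      fix h and n :: int
      assume h: "0 < h \<and> h < min h1 (1 / C)"
      show "\<exists>\<^sub>\<le>\<^sub>1 lam. lam \<in> {\<Lambda>1<..<\<Lambda>2} \<and> cos (Phi v l lam / h) + eps lam h = 0 \<and>
             \<bar>Phi v l lam - pi * (of_int n + 1/2) * h\<bar> \<le> C * h\<^sup>2"
      proof (rule quantized_energy_unique)
        show "h > 0" "\<kappa> > 0" "C * h \<le> 1" using h \<kappa>(1) C by (auto simp: field_simps)
        show "\<kappa> * (mu - lam) \<le> Phi v l mu - Phi v l lam"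
          if "lam \<in> {\<Lambda>1<..<\<Lambda>2}" "mu \<in> {\<Lambda>1<..<\<Lambda>2}" "lam < mu" for lam mu
          using that \<Lambda> by (intro \<kappa>(2)) auto
        show "(\<lambda>lam. eps lam h) field_differentiable at lam" if "lam \<in> {\<Lambda>1<..<\<Lambda>2}" for lam
          using h1(2)[of h] h that by (auto simp: Ck_on_def)
        show "\<bar>deriv (\<lambda>lam. eps lam h) lam\<bar> \<le> \<kappa> / 4 / h" if "lam \<in> {\<Lambda>1<..<\<Lambda>2}" for lam
          using h1(2)[of h] h that by auto
      qed
    qed
  qed
qed

end
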